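(* Let $V=\{1,\dots,n\}$ and $f:2^V\to\mathbb{R}$ be submodular with $f(\emptyset)=0$. Let $A=\{j: f(j\mid\emptyset)<0\}$, $B=\{j: f(j\mid V\setminus\{j\})\le 0\}$, let $A_+$ be the set returned by MMin-I started at $X^0=\emptyset$, and let $B_+$ be the set returned by MMin-II started at $X^0=V$. Then for every minimizer $X^*$ of $f$ over $2^V$ with $A\subseteq X^*\subseteq B$, we have $A\subseteq A_+\subseteq X^*\subseteq B_+\subseteq B$. Consequently, the set of all global minimizers of $f$ is contained in $\{X: A_+\subseteq X\subseteq B_+\}$, which is contained in $\{X: A\subseteq X\subseteq B\}$. Furthermore, MMin-I started at $\emptyset$ and MMin-II started at $V$ each terminate after $O(n)$ iterations, and their outputs are local minima of $f$.
   Context: Notation: $f(j\mid S)=f(S\cup\{j\})-f(S)$; $x(X)=\sum_{j\in X}x(j)$ for $x\in\mathbb{R}^V$. For $Y\subseteq V$ define vectors $\hat g_Y,\check g_Y\in\mathbb{R}^V$ by: $\hat g_Y(j)=f(j\mid V\setminus\{j\})$ for $j\in Y$ and $\hat g_Y(j)=f(j\mid Y)$ for $j\notin Y$; $\check g_Y(j)=f(j\mid Y\setminus\{j\})$ for $j\in Y$ and $\check g_Y(j)=f(j\mid\emptyset)$ for $j\notin Y$. MMin-I (resp. MMin-II) is the iteration: given $X^t$, let $X^{t+1}$ be the minimum-cardinality minimizer over $X\subseteq V$ of $f(X^t)+g(X)-g(X^t)$ with $g=\hat g_{X^t}$ (resp. $g=\check g_{X^t}$), i.e. $X^{t+1}=\{j: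 g(j)<0\}$; stop when $X^{t+1}=X^t$ and return that set. A set $X$ is a local minimum of $f$ if $f(X)\le f(Y)$ for every $Y$ that differs from $X$ by exactly one element.
   Formalization: As stated this fails for f = 0 (MMin-II from V returns ∅ but V is a minimizer); here B_+ comes from MMin-II with the maximum-cardinality minimizer {j: g(j) ≤ 0}; for the original MMin-II, X* ⊆ B_+ is claimed only for minimum-cardinality minimizers X* of f. *)

theory Defs
  imports Complex_Main "HOL-Library.Landau_Symbols"
begin

definition submodular_on :: "'a set \<Rightarrow> ('a set \<Rightarrow> real) \<Rightarrow> bool" where
  "submodular_on V f \<longleftrightarrow>
     (\<forall>X Y. X \<subseteq> V \<longrightarrow> Y \<subseteq> V \<longrightarrow> f (X \<union> Y) + f (X \<inter> Y) \<le> f X + f Y)"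

definition gain :: "('a set \<Rightarrow> real) \<Rightarrow> 'a \<Rightarrow> 'a set \<Rightarrow> real" where
  "gain f j S = f (S \<union> {j}) - f S"

definition minimizer :: "'a set \<Rightarrow> ('a set \<Rightarrow> real) \<Rightarrow> 'a set \<Rightarrow> bool" where
  "minimizer V F = is_arg_min F (\<lambda>X. X \<subseteq> V)"

definition min_card_minimizer :: "'a set \<Rightarrow> ('a set \<Rightarrow> real) \<Rightarrow> 'a set \<Rightarrow> bool" where
  "min_card_minimizer V F = is_arg_min card (minimizer V F)"

definition max_card_minimizer :: "'a set \<Rightarrow> ('a set \<Rightarrow> real) \<Rightarrow> 'a set \<Rightarrow> bool" where
  "max_card_minimizer V F = is_arg_max card (minimizer V F)"

definition local_minimum :: "'a set \<Rightarrow> ('a set \<Rightarrow> real) \<Rightarrow> 'a set \<Rightarrow> bool" where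
  "local_minimum V f X \<longleftrightarrow>
     X \<subseteq> V \<and> (\<forall>Y. Y \<subseteq> V \<longrightarrow> card ((X - Y) \<union> (Y - X)) = 1 \<longrightarrow> f X \<le> f Y)"

definition g_hat :: "'a set \<Rightarrow> ('a set \<Rightarrow> real) \<Rightarrow> 'a set \<Rightarrow> 'a \<Rightarrow> real" where
  "g_hat V f Y j = (if j \<in> Y then gain f j (V - {j}) else gain f j Y)"

definition g_check :: "('a set \<Rightarrow> real) \<Rightarrow> 'a set \<Rightarrow> 'a \<Rightarrow> real" where
  "g_check f Y j = (if j \<in> Y then gain f j (Y - {j}) else gain f j {})"

definition modular_model ::
    "('a set \<Rightarrow> real) \<Rightarrow> ('a \<Rightarrow> real) \<Rightarrow> 'a set \<Rightarrow> 'a set \<Rightarrow> real" where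
  "modular_model f g Y X = f Y + sum g X - sum g Y"

text \<open>
  The choice operator in the update rules is harmless: for finite \<open>V\<close> the minimizers of minimum
  and of maximum cardinality are unique, see \<open>min_card_minimizer_modular_model\<close> and
  \<open>max_card_minimizer_modular_model\<close> below.
\<close>

definition mmin_I :: "'a set \<Rightarrow> ('a set \<Rightarrow> real) \<Rightarrow> 'a set \<Rightarrow> 'a set" where
  "mmin_I V f Y = (SOME X. min_card_minimizer V (modular_model f (g_hat V f Y) Y) X)"

definition mmin_II :: "'a set \<Rightarrow> ('a set \<Rightarrow> real) \<Rightarrow> 'a set \<Rightarrow> 'a set" where
  "mmin_II V f Y = (SOME X. min_card_minimizer V (modular_model f (g_check f Y) Y) X)"

text \<open>
  MMin-II with ties broken towards the largest minimizer, so that its first iterate from \<open>V\<close> is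
  \<open>{j \<in> V. gain f j (V - {j}) \<le> 0}\<close>.  With the smallest minimizer the final set need not contain
  every minimizer of \<open>f\<close>: for \<open>f = (\<lambda>_. 0)\<close> the rule \<open>mmin_II\<close> leads from \<open>V\<close> to \<open>{}\<close>, although
  \<open>V\<close> minimizes \<open>f\<close>.
\<close>

definition mmin_II_max :: "'a set \<Rightarrow> ('a set \<Rightarrow> real) \<Rightarrow> 'a set \<Rightarrow> 'a set" where
  "mmin_II_max V f Y = (SOME X. max_card_minimizer V (modular_model f (g_check f Y) Y) X)"

text \<open>
  \<open>stops_after step X0 k\<close>: the iteration performs exactly \<open>k\<close> updates, the last of which is the
  first one that leaves the current set unchanged.
\<close>

definition stops_after :: "('a set \<Rightarrow> 'a set) \<Rightarrow> 'a set \<Rightarrow> nat \<Rightarrow> bool" where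
  "stops_after step X0 k \<longleftrightarrow>
     (\<exists>t. k = Suc t \<and> (step ^^ Suc t) X0 = (step ^^ t) X0 \<and>
          (\<forall>s<t. (step ^^ Suc s) X0 \<noteq> (step ^^ s) X0))"

definition returns :: "('a set \<Rightarrow> 'a set) \<Rightarrow> 'a set \<Rightarrow> 'a set \<Rightarrow> bool" where
  "returns step X0 R \<longleftrightarrow> (\<exists>k. stops_after step X0 k \<and> R = (step ^^ k) X0)"

lemma minimizer_modular_model:
  assumes fin: "finite V"
  shows "minimizer V (modular_model f g Y) X \<longleftrightarrow>
           {j \<in> V. g j < 0} \<subseteq> X \<and> X \<subseteq> {j \<in> V. g j \<le> 0}"
proof
  assume m: "minimizer V (modular_model f g Y) X"
  then have XV: "X \<subseteq> V" and le: "\<And>Z. Z \<subseteq> V \<Longrightarrow> sum g X \<le> sum g Z"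
    by (simp_all add: minimizer_def is_arg_min_linorder modular_model_def)
  have finX: "finite X"
    using XV fin finite_subset by blast
  have "j \<in> X" if "j \<in> V" "g j < 0" for j
    using le[of "insert j X"] XV finX that by (cases "j \<in> X") auto
  moreover have "g j \<le> 0" if "j \<in> X" for j
    using le[of "X - {j}"] XV finX that by (auto simp: sum_diff1)
  ultimately show "{j \<in> V. g j < 0} \<subseteq> X \<and> X \<subseteq> {j \<in> V. g j \<le> 0}"
    using XV by auto
next
  assume X: "{j \<in> V. g j < 0} \<subseteq> X \<and> X \<subseteq> {j \<in> V. g j \<le> 0}"
  have "sum g X \<le> sum g Z" if "Z \<subseteq> V" for Z
  proof -
    have "sum g X = (\<Sum>j\<in>V. if j \<in> X then g j else 0)"
      using sum.inter_restrict[OF fin, of g X] inf.absorb2[of X V] X by (simp add: subset_iff)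
    also have "\<dots> \<le> (\<Sum>j\<in>V. if j \<in> Z then g j else 0)"
      using X by (intro sum_mono) (auto simp: subset_iff not_less)
    also have "\<dots> = sum g Z"
      using sum.inter_restrict[OF fin, of g Z] that by (simp add: inf.absorb2)
    finally show ?thesis .
  qed
  then show "minimizer V (modular_model f g Y) X"
    using X by (simp add: minimizer_def is_arg_min_linorder modular_model_def subset_iff)
qed

lemma min_card_minimizer_modular_model:
  assumes fin: "finite V"
  shows "min_card_minimizer V (modular_model f g Y) X \<longleftrightarrow> X = {j \<in> V. g j < 0}"
proof -
  let ?N = "{j \<in> V. g j < 0}"
  have N: "minimizer V (modular_model f g Y) ?N"
    unfolding minimizer_modular_model[OF fin] by auto
  have sub: "?N \<subseteq> Z" "finite Z" if "minimizer V (modular_model f g Y) Z" for Z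
    using that fin unfolding minimizer_modular_model[OF fin] by (auto intro: finite_subset)
  show ?thesis
  proof
    assume "min_card_minimizer V (modular_model f g Y) X"
    then have X: "minimizer V (modular_model f g Y) X" and "\<not> card ?N < card X"
      using N unfolding min_card_minimizer_def is_arg_min_def by blast+
    with sub[OF X] show "X = ?N"
      using card_seteq[of X ?N] by simp
  next
    assume "X = ?N"
    moreover have "\<not> card Z < card ?N" if "minimizer V (modular_model f g Y) Z" for Z
      using card_mono[OF sub(2,1)[OF that]] by simp
    ultimately show "min_card_minimizer V (modular_model f g Y) X"
      using N unfolding min_card_minimizer_def is_arg_min_def by blast
  qed
qed

lemma max_card_minimizer_modular_model:
  assumes fin: "finite V"
  shows "max_card_minimizer V (modular_model f g Y) X \<longleftrightarrow> X = {j \<in> V. g j \<le> 0}"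
proof -
  let ?N = "{j \<in> V. g j \<le> 0}"
  have N: "minimizer V (modular_model f g Y) ?N" and finN: "finite ?N"
    unfolding minimizer_modular_model[OF fin] using fin by auto
  have sub: "Z \<subseteq> ?N" if "minimizer V (modular_model f g Y) Z" for Z
    using that unfolding minimizer_modular_model[OF fin] by auto
  show ?thesis
  proof
    assume "max_card_minimizer V (modular_model f g Y) X"
    then have X: "minimizer V (modular_model f g Y) X" and "\<not> card ?N > card X"
      using N unfolding max_card_minimizer_def is_arg_max_def by blast+
    with sub[OF X] show "X = ?N"
      using card_seteq[OF finN, of X] by simp
  next
    assume "X = ?N"
    moreover have "\<not> card Z > card ?N" if "minimizer V (modular_model f g Y) Z" for Z
      using card_mono[OF finN sub[OF that]] by simp
    ultimately show "max_card_minimizer V (modular_model f g Y) X"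
      using N unfolding max_card_minimizer_def is_arg_max_def by blast
  qed
qed

lemma mmin_eqs:
  assumes "finite V"
  shows mmin_I_eq: "mmin_I V f Y = {j \<in> V. g_hat V f Y j < 0}"
    and mmin_II_eq: "mmin_II V f Y = {j \<in> V. g_check f Y j < 0}"
    and mmin_II_max_eq: "mmin_II_max V f Y = {j \<in> V. g_check f Y j \<le> 0}"
  by (simp_all add: mmin_I_def mmin_II_def mmin_II_max_def
      min_card_minimizer_modular_model[OF assms] max_card_minimizer_modular_model[OF assms])

end

theory Submission
  imports Defs
begin

text \<open>
  Submodularity makes gains antitone in the base set.  Hence an element that MMin-I adds has negative
  gain over every later iterate and over every set containing it, so the iterates from \<open>{}\<close> only
  grow and stay inside every minimizer; at the fixed point all single insertions and deletions are
  unprofitable.  MMin-II from \<open>V\<close> is dual.  Both of its tie-breaking rules are treated at once: an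
  iterate is \<open>{j \<in> V. P (g_check f Y j)}\<close> for a down-closed predicate \<open>P\<close> between \<open>\<lambda>x. x < 0\<close> and
  \<open>\<lambda>x. x \<le> 0\<close>.
\<close>

section \<open>Stopping iterations: invariants and an iteration bound\<close>

text \<open>The last counted update changes nothing, so the returned set is at once an iterate,
  which carries the invariant, and a fixed point.\<close>

lemma returns_invariant:
  assumes "returns step X0 R" "P X0" "\<And>X. P X \<Longrightarrow> P (step X)"
  shows "P R \<and> step R = R"
proof -
  have inv: "P ((step ^^ t) X0)" for t
    by (induction t) (use assms(2,3) in auto)
  from assms(1) obtain t where
    "(step ^^ Suc t) X0 = (step ^^ t) X0" "R = (step ^^ Suc t) X0"
    unfolding returns_def stops_after_def by blast
  with inv[of t] show ?thesis by simp
qed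

text \<open>Each update that moves the set costs at least one unit of \<open>m\<close>. The extra
  \<open>Suc\<close> counts the final update, which leaves the set unchanged.\<close>

lemma stops_after_measure:
  fixes m :: "'a set \<Rightarrow> nat"
  assumes "P X0" "\<And>X. P X \<Longrightarrow> P (step X)"
    and decr: "\<And>X. P X \<Longrightarrow> step X \<noteq> X \<Longrightarrow> m (step X) < m X"
  shows "\<exists>k. stops_after step X0 k \<and> k \<le> Suc (m X0)"
proof -
  let ?fix = "\<lambda>t. (step ^^ Suc t) X0 = (step ^^ t) X0"
  have inv: "P ((step ^^ t) X0)" for t
    by (induction t) (use assms(1,2) in auto)
  have bound: "m ((step ^^ t) X0) + t \<le> m X0" if "\<forall>s<t. \<not> ?fix s" for t
    using that
  proof (induction t)
    case (Suc t)
    then have "m ((step ^^ Suc t) X0) < m ((step ^^ t) X0)"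
      using decr[OF inv[of t]] by simp
    with Suc show ?case by simp
  qed simp
  have ex: "\<exists>t. ?fix t"
    using bound[of "Suc (m X0)"] by force
  \<comment> \<open>Minimality serves twice: \<open>stops_after\<close> demands the first unchanged
    update, and \<open>bound\<close> applies only before it.\<close>
  define t where "t = (LEAST t. ?fix t)"
  have "?fix t" unfolding t_def by (rule LeastI_ex[OF ex])
  moreover have min: "\<forall>s<t. \<not> ?fix s" unfolding t_def using not_less_Least by blast
  ultimately have "stops_after step X0 (Suc t)"
    unfolding stops_after_def by blast
  with bound[OF min] show ?thesis by auto
qed

section \<open>Marginal gains, local minima and minimizers\<close>

text \<open>This is submodularity for the pair \<open>S \<union> {j}\<close> and \<open>T\<close>,
  whose intersection is \<open>S\<close> because \<open>j\<close> lies outside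
  \<open>T\<close>.\<close>

lemma gain_antimono:
  assumes "submodular_on V f" "S \<subseteq> T" "T \<subseteq> V" "j \<in> V" "j \<notin> T"
  shows "gain f j T \<le> gain f j S"
proof -
  have "(S \<union> {j}) \<union> T = T \<union> {j}" "(S \<union> {j}) \<inter> T = S"
    using assms by auto
  moreover have "f ((S \<union> {j}) \<union> T) + f ((S \<union> {j}) \<inter> T) \<le> f (S \<union> {j}) + f T"
    using assms(1)[unfolded submodular_on_def, rule_format, of "S \<union> {j}" T] assms by auto
  ultimately show ?thesis by (simp add: gain_def)
qed

lemma gain_delete: "j \<in> X \<Longrightarrow> gain f j (X - {j}) = f X - f (X - {j})"
  by (simp add: gain_def insert_absorb)

lemma local_minimumI:
  assumes "X \<subseteq> V"
    and ins: "\<And>j. j \<in> V - X \<Longrightarrow> 0 \<le> gain f j X"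
    and del: "\<And>j. j \<in> X \<Longrightarrow> gain f j (X - {j}) \<le> 0"
  shows "local_minimum V f X"
  unfolding local_minimum_def
proof (intro conjI allI impI)
  fix Y assume "Y \<subseteq> V" and "card ((X - Y) \<union> (Y - X)) = 1"
  then obtain j where j: "(X - Y) \<union> (Y - X) = {j}"
    by (auto simp: card_1_singleton_iff)
  show "f X \<le> f Y"
  proof (cases "j \<in> X")
    case True
    then have "Y = X - {j}" using j by blast
    with del[OF True] True show ?thesis by (simp add: gain_delete)
  next
    case False
    then have "j \<in> V - X" using j \<open>Y \<subseteq> V\<close> by blast
    moreover have "Y = X \<union> {j}"
    proof
      show "Y \<subseteq> X \<union> {j}" using j by blast
      have "j \<in> (X - Y) \<union> (Y - X)" using j by simp
      with False have "j \<in> Y" by simp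
      moreover have "X - Y \<subseteq> {j}" using j by blast
      ultimately show "X \<union> {j} \<subseteq> Y" by blast
    qed
    ultimately show ?thesis using ins[of j] by (simp add: gain_def)
  qed
qed (fact \<open>X \<subseteq> V\<close>)

lemma minimizer_gain_insert:
  assumes "minimizer V f X" "j \<in> V"
  shows "0 \<le> gain f j X"
  using assms by (auto simp: minimizer_def is_arg_min_linorder gain_def)

lemma minimizer_gain_delete:
  assumes "minimizer V f X" "j \<in> X"
  shows "gain f j (X - {j}) \<le> 0"
proof -
  have "X - {j} \<subseteq> V"
    using assms by (auto simp: minimizer_def is_arg_min_def)
  then have "f X \<le> f (X - {j})"
    using assms by (simp add: minimizer_def is_arg_min_linorder)
  with assms show ?thesis by (simp add: gain_delete)
qed

text \<open>Otherwise deleting \<open>j\<close> would yield a smaller minimizer. The strict sign is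
  what the strict rule \<open>mmin_II\<close> needs in order to keep \<open>j\<close>.\<close>

lemma min_card_minimizer_gain_delete:
  assumes "finite V" "min_card_minimizer V f X" "j \<in> X"
  shows "gain f j (X - {j}) < 0"
proof (rule ccontr)
  assume "\<not> gain f j (X - {j}) < 0"
  then have le: "f (X - {j}) \<le> f X"
    using assms by (simp add: gain_delete)
  have X: "minimizer V f X"
    and card: "\<And>Z. minimizer V f Z \<Longrightarrow> card X \<le> card Z"
    using assms(2) by (auto simp: min_card_minimizer_def is_arg_min_linorder)
  then have "minimizer V f (X - {j})"
    using le order_trans[OF le] by (simp add: minimizer_def is_arg_min_linorder subset_iff)
  moreover have "finite X"
    using X assms(1) by (auto simp: minimizer_def is_arg_min_def intro: finite_subset)
  ultimately show False
    using card[of "X - {j}"] card_Diff1_less[of X j] assms(3) by simp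
qed

section \<open>MMin-I from the empty set\<close>

locale submodular_function =
  fixes V :: "'a set" and f :: "'a set \<Rightarrow> real"
  assumes finite_V: "finite V" and submodular: "submodular_on V f"
begin

lemmas gain_antimono = gain_antimono[OF submodular]

text \<open>Invariant of MMin-I from \<open>{}\<close>: deleting any single element strictly
  increases \<open>f\<close>.\<close>

definition addable :: "'a set \<Rightarrow> bool" where
  "addable X \<longleftrightarrow> X \<subseteq> V \<and> (\<forall>j\<in>X. gain f j (X - {j}) < 0)"

text \<open>On members of \<open>X\<close>, \<open>g_hat\<close> is the gain over
  \<open>V - {j}\<close>, which is at most the negative gain over \<open>X - {j}\<close>; hence no
  element is dropped.\<close>

lemma mmin_I_addable:
  assumes "addable X"
  shows "mmin_I V f X = X \<union> {j \<in> V - X. gain f j X < 0}"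
proof -
  have "gain f j (V - {j}) < 0" if "j \<in> X" for j
  proof -
    have "gain f j (V - {j}) \<le> gain f j (X - {j})"
      using assms that by (intro gain_antimono) (auto simp: addable_def)
    with assms that show ?thesis by (force simp: addable_def)
  qed
  with assms show ?thesis
    by (auto simp: mmin_I_eq[OF finite_V] g_hat_def addable_def split: if_splits)
qed

text \<open>Elements entering together do not spoil each other: a larger base set only lowers the
  gain that let them in.\<close>

lemma addable_mmin_I:
  assumes "addable X"
  shows "addable (mmin_I V f X)"
  unfolding addable_def
proof (intro conjI ballI)
  let ?X = "mmin_I V f X"
  show sub: "?X \<subseteq> V" by (auto simp: mmin_I_eq[OF finite_V])
  fix j assume j: "j \<in> ?X"
  have "gain f j (?X - {j}) \<le> gain f j (X - {j})"
    using j sub by (intro gain_antimono) (auto simp: mmin_I_addable[OF assms])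
  moreover have "gain f j (X - {j}) < 0"
    using j assms by (cases "j \<in> X") (auto simp: mmin_I_addable[OF assms] addable_def)
  ultimately show "gain f j (?X - {j}) < 0" by simp
qed

text \<open>An element entering from outside \<open>Z\<close> would have negative gain over
  \<open>X\<close>, hence over the larger set \<open>Z\<close>. Minimizers are the intended
  \<open>Z\<close>.\<close>

lemma mmin_I_subset:
  assumes "addable X" "X \<subseteq> Z" "Z \<subseteq> V" and Z: "\<And>j. j \<in> V - Z \<Longrightarrow> 0 \<le> gain f j Z"
  shows "mmin_I V f X \<subseteq> Z"
proof
  fix j assume j: "j \<in> mmin_I V f X"
  show "j \<in> Z"
  proof (rule ccontr)
    assume "j \<notin> Z"
    with j assms have "j \<in> V - Z" "gain f j X < 0"
      by (auto simp: mmin_I_addable)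
    moreover from this have "gain f j Z \<le> gain f j X"
      using assms by (intro gain_antimono) auto
    ultimately show False using Z[of j] by simp
  qed
qed

lemma addable_empty: "addable {}"
  by (simp add: addable_def)

lemma mmin_I_stops: "\<exists>k. stops_after (mmin_I V f) {} k \<and> k \<le> Suc (card V)"
proof -
  have "card (V - mmin_I V f X) < card (V - X)" if "addable X" "mmin_I V f X \<noteq> X" for X
    using that finite_V by (intro psubset_card_mono) (auto simp: mmin_I_addable)
  then show ?thesis
    using stops_after_measure[of addable "{}" "mmin_I V f" "\<lambda>X. card (V - X)"]
      addable_empty addable_mmin_I by simp
qed

lemma mmin_I_returns:
  assumes "returns (mmin_I V f) {} R"
  shows "local_minimum V f R" and "{j \<in> V. gain f j {} < 0} \<subseteq> R"
    and "minimizer V f Z \<Longrightarrow> R \<subseteq> Z"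
proof -
  have R: "addable R" and "mmin_I V f R = R"
    using returns_invariant[of _ _ _ addable, OF assms addable_empty addable_mmin_I] by auto
  then have out: "0 \<le> gain f j R" if "j \<in> V - R" for j
    using that by (fastforce simp: mmin_I_addable)
  show "local_minimum V f R"
    using R out by (intro local_minimumI) (auto simp: addable_def less_imp_le)
  show "{j \<in> V. gain f j {} < 0} \<subseteq> R"
  proof
    fix j assume j: "j \<in> {j \<in> V. gain f j {} < 0}"
    \<comment> \<open>If \<open>j\<close> were outside \<open>R\<close>, its negative gain over
      \<open>{}\<close> would bound its gain over \<open>R\<close>, contradicting
      \<open>out\<close>.\<close>
    show "j \<in> R"
      using gain_antimono[of "{}" R j] out[of j] j R by (force simp: addable_def)
  qed
  show "R \<subseteq> Z" if Z: "minimizer V f Z"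
  proof -
    have "Z \<subseteq> V" using Z by (simp add: minimizer_def is_arg_min_def)
    then have "addable (mmin_I V f X) \<and> mmin_I V f X \<subseteq> Z" if "addable X \<and> X \<subseteq> Z" for X
      using that minimizer_gain_insert[OF Z] addable_mmin_I mmin_I_subset by blast
    then show ?thesis
      using returns_invariant[of _ _ _ "\<lambda>X. addable X \<and> X \<subseteq> Z", OF assms] addable_empty by simp
  qed
qed

end

section \<open>MMin-II from the ground set, for both tie-breaking rules\<close>

text \<open>The assumptions fix \<open>P\<close> everywhere except at 0, where its value decides
  whether ties are kept.\<close>

locale submodular_threshold = submodular_function +
  fixes P :: "real \<Rightarrow> bool"
  assumes P_neg: "x < 0 \<Longrightarrow> P x" and P_nonpos: "P x \<Longrightarrow> x \<le> 0"
begin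

lemma P_down: "P y \<Longrightarrow> x \<le> y \<Longrightarrow> P x"
  using P_neg[of x] P_nonpos[of y] by (cases "x = y") auto

definition shrink :: "'a set \<Rightarrow> 'a set" where
  "shrink Y = {j \<in> V. P (g_check f Y j)}"

text \<open>Dual invariant: no element outside \<open>Y\<close> passes the test for being
  kept.\<close>

definition removable :: "'a set \<Rightarrow> bool" where
  "removable Y \<longleftrightarrow> Y \<subseteq> V \<and> (\<forall>j\<in>V - Y. \<not> P (gain f j Y))"

text \<open>Deleted elements never return: outside \<open>Y\<close>, \<open>g_check\<close> is the
  gain over \<open>{}\<close>, and if it satisfied \<open>P\<close>, so would the smaller gain over
  \<open>Y\<close>.\<close>

lemma shrink_removable:
  assumes "removable Y"
  shows "shrink Y = {j \<in> Y. P (gain f j (Y - {j}))}"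
proof -
  have "\<not> P (gain f j {})" if "j \<in> V - Y" for j
    using P_down[of "gain f j {}" "gain f j Y"] gain_antimono[of "{}" Y j] assms that
    by (auto simp: removable_def)
  with assms show ?thesis
    by (auto simp: shrink_def g_check_def removable_def)
qed

lemma removable_shrink:
  assumes "removable Y"
  shows "removable (shrink Y)"
  unfolding removable_def
proof (intro conjI ballI)
  show "shrink Y \<subseteq> V" by (auto simp: shrink_def)
  fix j assume j: "j \<in> V - shrink Y"
  \<comment> \<open>As \<open>j\<close> is not in \<open>shrink Y\<close>, that set lies inside
    \<open>Y - {j}\<close>, whether or not \<open>j\<close> was in \<open>Y\<close>.\<close>
  have "gain f j (Y - {j}) \<le> gain f j (shrink Y)"
    using j assms by (intro gain_antimono) (auto simp: shrink_removable[OF assms] removable_def)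
  moreover have "\<not> P (gain f j (Y - {j}))"
    using j assms by (cases "j \<in> Y") (auto simp: shrink_removable[OF assms] removable_def)
  ultimately show "\<not> P (gain f j (shrink Y))"
    using P_down by blast
qed

lemma subset_shrink:
  assumes "removable Y" "Z \<subseteq> Y" and Z: "\<And>j. j \<in> Z \<Longrightarrow> P (gain f j (Z - {j}))"
  shows "Z \<subseteq> shrink Y"
proof
  fix j assume j: "j \<in> Z"
  have "gain f j (Y - {j}) \<le> gain f j (Z - {j})"
    using assms j by (intro gain_antimono) (auto simp: removable_def)
  with Z[OF j] have "P (gain f j (Y - {j}))" by (rule P_down)
  with assms j show "j \<in> shrink Y" by (auto simp: shrink_removable)
qed

lemma removable_V: "removable V"
  by (simp add: removable_def)

lemma shrink_stops: "\<exists>k. stops_after shrink V k \<and> k \<le> Suc (card V)"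
proof -
  have "card (shrink Y) < card Y" if Y: "removable Y" "shrink Y \<noteq> Y" for Y
  proof (rule psubset_card_mono)
    show "finite Y" using Y finite_V by (auto simp: removable_def intro: finite_subset)
    show "shrink Y \<subset> Y" using Y by (auto simp: shrink_removable)
  qed
  then show ?thesis
    using stops_after_measure[of removable V shrink card] removable_V removable_shrink by simp
qed

text \<open>The condition on \<open>Z\<close> concerns deletion gains alone, so one argument covers
  all minimizers for the weak test and those of least cardinality for the strict one.\<close>

lemma shrink_returns:
  assumes "returns shrink V R"
  shows "local_minimum V f R" and "R \<subseteq> {j \<in> V. gain f j (V - {j}) \<le> 0}"
    and "Z \<subseteq> V \<Longrightarrow> (\<And>j. j \<in> Z \<Longrightarrow> P (gain f j (Z - {j}))) \<Longrightarrow> Z \<subseteq> R"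
proof -
  have R: "removable R" and "shrink R = R"
    using returns_invariant[of _ _ _ removable, OF assms removable_V removable_shrink] by auto
  then have inn: "gain f j (R - {j}) \<le> 0" if "j \<in> R" for j
    using that by (auto simp: shrink_removable intro!: P_nonpos)
  have "0 \<le> gain f j R" if "j \<in> V - R" for j
    using that R P_neg[of "gain f j R"] by (force simp: removable_def)
  with R inn show "local_minimum V f R"
    by (intro local_minimumI) (auto simp: removable_def)
  show "R \<subseteq> {j \<in> V. gain f j (V - {j}) \<le> 0}"
  proof
    fix j assume j: "j \<in> R"
    then have "gain f j (V - {j}) \<le> gain f j (R - {j})"
      using R by (intro gain_antimono) (auto simp: removable_def)
    with inn[OF j] j R show "j \<in> {j \<in> V. gain f j (V - {j}) \<le> 0}"
      by (auto simp: removable_def)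
  qed
  show "Z \<subseteq> R" if "Z \<subseteq> V" and Z: "\<And>j. j \<in> Z \<Longrightarrow> P (gain f j (Z - {j}))"
  proof -
    have "removable (shrink Y) \<and> Z \<subseteq> shrink Y" if "removable Y \<and> Z \<subseteq> Y" for Y
      using that Z removable_shrink subset_shrink by blast
    then show ?thesis
      using returns_invariant[of _ _ _ "\<lambda>Y. removable Y \<and> Z \<subseteq> Y", OF assms] removable_V that
      by simp
  qed
qed

end

section \<open>The strict and the weak rule as instances\<close>

context submodular_function
begin

interpretation II: submodular_threshold V f "\<lambda>x. x < 0"
  by unfold_locales auto

interpretation II_max: submodular_threshold V f "\<lambda>x. x \<le> 0"
  by unfold_locales auto

lemma mmin_II_shrink: "mmin_II V f = II.shrink"
  by (simp add: fun_eq_iff mmin_II_eq[OF finite_V] II.shrink_def)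

lemma mmin_II_max_shrink: "mmin_II_max V f = II_max.shrink"
  by (simp add: fun_eq_iff mmin_II_max_eq[OF finite_V] II_max.shrink_def)

lemma mmin_II_stops: "\<exists>k. stops_after (mmin_II V f) V k \<and> k \<le> Suc (card V)"
  unfolding mmin_II_shrink by (rule II.shrink_stops)

lemma mmin_II_max_stops: "\<exists>k. stops_after (mmin_II_max V f) V k \<and> k \<le> Suc (card V)"
  unfolding mmin_II_max_shrink by (rule II_max.shrink_stops)

text \<open>The upper containment is limited to least cardinality, since other minimizers may have
  deletion gain 0, which the strict test rejects.\<close>

lemma mmin_II_returns:
  assumes "returns (mmin_II V f) V R"
  shows "local_minimum V f R" and "R \<subseteq> {j \<in> V. gain f j (V - {j}) \<le> 0}"
    and "min_card_minimizer V f Z \<Longrightarrow> Z \<subseteq> R"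
proof -
  note R = II.shrink_returns[OF assms[unfolded mmin_II_shrink]]
  show "local_minimum V f R" "R \<subseteq> {j \<in> V. gain f j (V - {j}) \<le> 0}"
    by (fact R)+
  show "Z \<subseteq> R" if Z: "min_card_minimizer V f Z"
  proof (rule R(3))
    show "Z \<subseteq> V"
      using Z by (simp add: min_card_minimizer_def minimizer_def is_arg_min_def)
  qed (rule min_card_minimizer_gain_delete[OF finite_V Z])
qed

lemma mmin_II_max_returns:
  assumes "returns (mmin_II_max V f) V R"
  shows "local_minimum V f R" and "R \<subseteq> {j \<in> V. gain f j (V - {j}) \<le> 0}"
    and "minimizer V f Z \<Longrightarrow> Z \<subseteq> R"
proof -
  note R = II_max.shrink_returns[OF assms[unfolded mmin_II_max_shrink]]
  show "local_minimum V f R" "R \<subseteq> {j \<in> V. gain f j (V - {j}) \<le> 0}"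
    by (fact R)+
  show "Z \<subseteq> R" if Z: "minimizer V f Z"
  proof (rule R(3))
    show "Z \<subseteq> V"
      using Z by (simp add: minimizer_def is_arg_min_def)
  qed (rule minimizer_gain_delete[OF Z])
qed

end

section \<open>Sandwich containments and the linear iteration bound\<close>

theorem theorem4:
  shows "(\<forall>(n::nat) (f :: nat set \<Rightarrow> real) V A B A_plus B_plus.
            V = {1..n} \<longrightarrow> submodular_on V f \<longrightarrow> f {} = 0 \<longrightarrow>
            A = {j \<in> V. gain f j {} < 0} \<longrightarrow>
            B = {j \<in> V. gain f j (V - {j}) \<le> 0} \<longrightarrow>
            returns (mmin_I V f) {} A_plus \<longrightarrow>
            returns (mmin_II_max V f) V B_plus \<longrightarrow>
              (\<forall>X. minimizer V f X \<and> A \<subseteq> X \<and> X \<subseteq> B \<longrightarrow>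
                 A \<subseteq> A_plus \<and> A_plus \<subseteq> X \<and> X \<subseteq> B_plus \<and> B_plus \<subseteq> B) \<and>
              {X. minimizer V f X} \<subseteq> {X. A_plus \<subseteq> X \<and> X \<subseteq> B_plus} \<and>
              {X. A_plus \<subseteq> X \<and> X \<subseteq> B_plus} \<subseteq> {X. A \<subseteq> X \<and> X \<subseteq> B} \<and>
              local_minimum V f A_plus \<and> local_minimum V f B_plus \<and>
              (\<forall>B_min. returns (mmin_II V f) V B_min \<longrightarrow>
                 (\<forall>X. min_card_minimizer V f X \<and> A \<subseteq> X \<and> X \<subseteq> B \<longrightarrow>
                    A \<subseteq> A_plus \<and> A_plus \<subseteq> X \<and> X \<subseteq> B_min \<and> B_min \<subseteq> B) \<and>
                 {X. min_card_minimizer V f X} \<subseteq> {X. A_plus \<subseteq> X \<and> X \<subseteq> B_min} \<and>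
                 {X. A_plus \<subseteq> X \<and> X \<subseteq> B_min} \<subseteq> {X. A \<subseteq> X \<and> X \<subseteq> B} \<and>
                 local_minimum V f B_min))
       \<and> (\<exists>N :: nat \<Rightarrow> real. N \<in> O(\<lambda>n. real n) \<and>
            (\<forall>(n::nat) (f :: nat set \<Rightarrow> real).
               submodular_on {1..n} f \<longrightarrow> f {} = 0 \<longrightarrow>
                 (\<exists>k. stops_after (mmin_I {1..n} f) {} k \<and> real k \<le> N n) \<and>
                 (\<exists>k. stops_after (mmin_II_max {1..n} f) {1..n} k \<and> real k \<le> N n) \<and>
                 (\<exists>k. stops_after (mmin_II {1..n} f) {1..n} k \<and> real k \<le> N n)))"
proof (rule conjI, goal_cases)
  case 1
  \<comment> \<open>This transfers the lower containment of MMin-I, proved for all minimizers, to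
    those used with \<open>mmin_II\<close>.\<close>
  have min_card: "minimizer V f X" if "min_card_minimizer V f X"
    for V :: "nat set" and f :: "nat set \<Rightarrow> real" and X
    using that by (simp add: min_card_minimizer_def is_arg_min_def)
  show ?case
  proof (intro allI impI, goal_cases)
    case (1 n f V A B A_plus B_plus)
    interpret submodular_function V f
      using 1 by unfold_locales auto
    note I = mmin_I_returns[OF 1(6)] and II_max = mmin_II_max_returns[OF 1(7)]
    have A: "A \<subseteq> A_plus" and B: "B_plus \<subseteq> B"
      using I(2) II_max(2) 1(4,5) by simp_all
    have "(\<forall>X. min_card_minimizer V f X \<and> A \<subseteq> X \<and> X \<subseteq> B \<longrightarrow>
            A \<subseteq> A_plus \<and> A_plus \<subseteq> X \<and> X \<subseteq> B_min \<and> B_min \<subseteq> B) \<and>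
          {X. min_card_minimizer V f X} \<subseteq> {X. A_plus \<subseteq> X \<and> X \<subseteq> B_min} \<and>
          {X. A_plus \<subseteq> X \<and> X \<subseteq> B_min} \<subseteq> {X. A \<subseteq> X \<and> X \<subseteq> B} \<and>
          local_minimum V f B_min" if "returns (mmin_II V f) V B_min" for B_min
    proof -
      note II = mmin_II_returns[OF that]
      have "B_min \<subseteq> B"
        using II(2) 1(5) by simp
      with A I(3)[OF min_card] II(1,3) show ?thesis
        by (simp add: Collect_mono_iff) (meson subset_trans)
    qed
    moreover have "{X. minimizer V f X} \<subseteq> {X. A_plus \<subseteq> X \<and> X \<subseteq> B_plus}"
      using I(3) II_max(3) by auto
    moreover have "{X. A_plus \<subseteq> X \<and> X \<subseteq> B_plus} \<subseteq> {X. A \<subseteq> X \<and> X \<subseteq> B}"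
      using A B by auto
    ultimately show ?case
      using A B I(1,3) II_max(1,3) by simp
  qed
next
  case 2
  \<comment> \<open>The witness is \<open>Suc (card {1..n})\<close>, uniform in \<open>f\<close>;
    its summand 1 is dominated by \<open>n\<close> once \<open>n\<close> is at least 1.\<close>
  have "(\<lambda>n. real n + 1) \<in> O(\<lambda>n. real n)"
    by (intro sum_in_bigo bigoI[of _ 1]) (auto intro!: eventually_at_top_linorderI[of 1])
  moreover have "(\<exists>k. stops_after (mmin_I {1..n} f) {} k \<and> real k \<le> real n + 1) \<and>
      (\<exists>k. stops_after (mmin_II_max {1..n} f) {1..n} k \<and> real k \<le> real n + 1) \<and>
      (\<exists>k. stops_after (mmin_II {1..n} f) {1..n} k \<and> real k \<le> real n + 1)"
    if "submodular_on {1..n} f" for n :: nat and f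
  proof -
    interpret submodular_function "{1..n}" f
      using that by unfold_locales auto
    have "real k \<le> real n + 1" if "k \<le> Suc (card {1..n})" for k
      using that by simp
    then show ?thesis
      using mmin_I_stops mmin_II_max_stops mmin_II_stops by blast
  qed
  ultimately show ?case by blast
qed

end
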